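(* Let $\mathbf u$ be a uniformly recurrent infinite word over a finite alphabet whose language is closed under reversal. Then $$2D(\mathbf u)=\sum_{n=0}^{+\infty}T_{\mathbf u}(n),$$ where both sides may equal $+\infty$.
   Context: An infinite word $\mathbf u=u_0u_1u_2\ldots$ is over a finite alphabet $\mathcal A$. Its language $\mathcal L(\mathbf u)$ is the set of its finite factors; $\mathcal L_n(\mathbf u)$ is the set of factors of length $n$. The reversal of $w=w_0\ldots w_{n-1}$ is $\overline w=w_{n-1}\ldots w_0$; $w$ is a palindrome if $w=\overline w$ (the empty word is a palindrome). The language is closed under reversal if $w\in\mathcal L(\mathbf u)$ implies $\overline w\in\mathcal L(\mathbf u)$. $\mathbf u$ is uniformly recurrent if every factor occurs infinitely often and has only finitely many return words (equivalently, for every $n$ there is $R$ such that every factor of length at least $R$ contains all factors of length $n$). Factor complexity: $\mathcal C_{\mathbf u}(n)=\#\mathcal L_n(\mathbf u)$; palindromic complexity: $\mathcal P_{\mathbf u}(n)$ is the number of palindromes in $\mathcal L_n(\mathbf u)$. Define $T_{\mathbf u}(n)=\mathcal C_{\mathbf u}(n+1)-\mathcal C_{\mathbf u}(n)+2-\mathcal P_{\mathbf u}(n+1)-\mathcal P_{\mathbf u}(n)$ (for words with language closed under reversal this is always $\ge 0$). The defect of a finite word $w$ is $D(w)=|w|+1-(\text{number of distinct palindromic factors of } w\text{, including the empty word})$. The defect of an infinite word is $D(\mathbf u)=\sup\{D(w): w\text{ a prefix of }\mathbf u\}\in\mathbb N\cup\{+\infty\}$. *)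

theory Defs
  imports "HOL-Library.Extended_Real" "HOL-Library.Sublist"
begin

definition occurrences :: "(nat \<Rightarrow> 'a) \<Rightarrow> 'a list \<Rightarrow> nat set" where
  "occurrences u w = {i. map u [i..<i + length w] = w}"

definition language :: "(nat \<Rightarrow> 'a) \<Rightarrow> 'a list set" where
  "language u = {w. \<exists>i. map u [i..<i + length w] = w}"

definition language_n :: "(nat \<Rightarrow> 'a) \<Rightarrow> nat \<Rightarrow> 'a list set" where
  "language_n u n = {w \<in> language u. length w = n}"

definition palindrome :: "'a list \<Rightarrow> bool" where
  "palindrome w \<longleftrightarrow> w = rev w"

definition closed_under_reversal :: "(nat \<Rightarrow> 'a) \<Rightarrow> bool" where
  "closed_under_reversal u \<longleftrightarrow> (\<forall>w \<in> language u. rev w \<in> language u)"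

definition return_words :: "(nat \<Rightarrow> 'a) \<Rightarrow> 'a list \<Rightarrow> 'a list set" where
  "return_words u w =
     {map u [i..<j] | i j. i < j \<and> i \<in> occurrences u w \<and> j \<in> occurrences u w
        \<and> (\<forall>k. i < k \<and> k < j \<longrightarrow> k \<notin> occurrences u w)}"

definition uniformly_recurrent :: "(nat \<Rightarrow> 'a) \<Rightarrow> bool" where
  "uniformly_recurrent u \<longleftrightarrow>
     (\<forall>w \<in> language u. infinite (occurrences u w) \<and> finite (return_words u w))"

definition factor_complexity :: "(nat \<Rightarrow> 'a) \<Rightarrow> nat \<Rightarrow> nat" where
  "factor_complexity u n = card (language_n u n)"

definition palindromic_complexity :: "(nat \<Rightarrow> 'a) \<Rightarrow> nat \<Rightarrow> nat" where
  "palindromic_complexity u n = card {w \<in> language_n u n. palindrome w}"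

text \<open>Computed in \<^typ>\<open>int\<close>, so that no subtraction is truncated; the same
  applies to the defect of a finite word below.\<close>
definition T :: "(nat \<Rightarrow> 'a) \<Rightarrow> nat \<Rightarrow> int" where
  "T u n = int (factor_complexity u (n + 1)) - int (factor_complexity u n) + 2
           - int (palindromic_complexity u (n + 1)) - int (palindromic_complexity u n)"

definition word_defect :: "'a list \<Rightarrow> int" where
  "word_defect w = int (length w) + 1 - int (card {p. sublist p w \<and> palindrome p})"

definition defect :: "(nat \<Rightarrow> 'a) \<Rightarrow> ereal" where
  "defect u = (SUP n. ereal (of_int (word_defect (map u [0..<n]))))"

end

theory Submission
  imports Defs
begin

text \<open>
  Scan \<open>u\<close> from left to right and record, for each factor \<open>v\<close>, the length \<open>first_end u v\<close> of the
  shortest prefix in which \<open>v\<close> or its reversal occurs. Every such length comes from at most one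
  palindrome, and at most one pair \<open>{v, rev v}\<close> of words of length \<open>N\<close>. Since there are
  \<open>(C(N) + P(N)) / 2\<close> such pairs, telescoping gives
  \<open>T(0) + \<dots> + T(N - 1) = 2 (N + #pairs - #palindromes of length at most N)\<close>.
  A palindrome longer than \<open>N\<close> never appears first together with a new pair, because it starts with
  the reversal of its suffix of length \<open>N\<close>; counting positions in a long prefix \<open>x\<close> bounds the
  partial sum by \<open>2 D(x)\<close>. Conversely, a palindrome of length at most \<open>N\<close> that is missing in the
  prefix of length \<open>N\<close> can only appear first together with a new pair, so the partial sum is at least
  twice the defect of that prefix.
\<close>

section \<open>First occurrences up to reversal\<close>

abbreviation pre :: "(nat \<Rightarrow> 'a) \<Rightarrow> nat \<Rightarrow> 'a list" where
  "pre u n \<equiv> map u [0..<n]"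

text \<open>If neither \<open>v\<close> nor \<open>rev v\<close> is a factor of \<open>u\<close>, no
  such \<open>j\<close> exists and the value is arbitrary; hence the membership assumptions
  below.\<close>

definition first_end :: "(nat \<Rightarrow> 'a) \<Rightarrow> 'a list \<Rightarrow> nat" where
  "first_end u v = (LEAST j. sublist v (pre u j) \<or> sublist (rev v) (pre u j))"

lemma sublist_pre_imp_language:
  assumes "sublist v (pre u j)"
  shows "v \<in> language u"
proof -
  obtain a b where ab: "pre u j = a @ v @ b"
    using assms by (auto simp: sublist_def)
  then have j: "j = length a + length v + length b"
    by (metis diff_zero length_append length_map length_upt add.assoc)
  have "map u [length a..<length a + length v] = take (length v) (drop (length a) (pre u j))"
    by (simp add: drop_map take_map j)
  also have "\<dots> = v"
    by (simp add: ab)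
  finally show ?thesis
    by (auto simp: language_def)
qed

lemma language_imp_suffix_pre:
  assumes "v \<in> language u"
  obtains j where "suffix v (pre u j)"
proof -
  obtain i where i: "map u [i..<i + length v] = v"
    using assms by (auto simp: language_def)
  have "pre u (i + length v) = pre u i @ v"
    by (subst upt_add_eq_append) (simp_all add: i)
  then show ?thesis
    using that by (auto simp: suffix_def)
qed

lemma pre_mono: "i \<le> j \<Longrightarrow> prefix (pre u i) (pre u j)"
  by (metis map_mono_prefix le_add_diff_inverse prefix_def upt_add_eq_append zero_le)

lemma pre_eq_append: "pre u j = a @ b \<Longrightarrow> a = pre u (length a)"
  by (metis append_eq_conv_conj length_append length_map length_upt diff_zero le_add1 take_map
      take_upt add_0)

lemma first_end_sublist:
  assumes "v \<in> language u"
  shows "sublist v (pre u (first_end u v)) \<or> sublist (rev v) (pre u (first_end u v))"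
proof -
  obtain j where "suffix v (pre u j)"
    using assms by (rule language_imp_suffix_pre)
  then have "sublist v (pre u j) \<or> sublist (rev v) (pre u j)"
    by auto
  then show ?thesis
    unfolding first_end_def by (rule LeastI)
qed

lemma first_end_le:
  assumes "sublist v (pre u j) \<or> sublist (rev v) (pre u j)"
  shows "first_end u v \<le> j"
  using assms unfolding first_end_def by (rule Least_le)

text \<open>The two alternatives in \<open>first_end\<close> coincide for a palindrome, so it marks
  a true first occurrence, which persists in all longer prefixes.\<close>

lemma palindrome_sublist_pre_iff:
  assumes "p \<in> language u" "palindrome p"
  shows "sublist p (pre u j) \<longleftrightarrow> first_end u p \<le> j"
proof
  assume "first_end u p \<le> j"
  then have "sublist (pre u (first_end u p)) (pre u j)"
    using pre_mono by blast
  moreover have "sublist p (pre u (first_end u p))"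
    using first_end_sublist[OF assms(1)] assms(2) by (auto simp: palindrome_def)
  ultimately show "sublist p (pre u j)"
    by (rule sublist_order.order_trans[rotated])
qed (simp add: first_end_le)

text \<open>By minimality: an occurrence ending earlier would already lie in a shorter
  prefix.\<close>

lemma sublist_pre_first_end_imp_suffix:
  assumes "sublist w (pre u (first_end u v))" and "w = v \<or> w = rev v"
  shows "suffix w (pre u (first_end u v))"
proof -
  obtain a b where ab: "pre u (first_end u v) = (a @ w) @ b"
    using assms by (auto simp: sublist_def)
  then have "sublist w (pre u (length (a @ w)))"
    using pre_eq_append[OF ab] by (metis sublist_appendI append_Nil2)
  then have "first_end u v \<le> length (a @ w)"
    using assms(2) by (intro first_end_le) auto
  moreover have "first_end u v = length (a @ w) + length b"
    using arg_cong[OF ab, of length] by simp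
  ultimately show ?thesis
    using ab by (auto simp: suffix_def)
qed

lemma first_end_suffix:
  assumes "v \<in> language u"
  obtains w where "w = v \<or> w = rev v" and "suffix w (pre u (first_end u v))"
  using first_end_sublist[OF assms] sublist_pre_first_end_imp_suffix that by metis

lemma length_le_first_end:
  assumes "v \<in> language u"
  shows "length v \<le> first_end u v"
  using first_end_suffix[OF assms] suffix_length_le
  by (metis diff_zero length_map length_rev length_upt)

text \<open>Each word, or its reversal, is a suffix of the same prefix, and suffixes of equal length
  coincide.\<close>

lemma first_end_eq_imp:
  assumes "v \<in> language u" "w \<in> language u" "length v = length w"
    and "first_end u v = first_end u w"
  shows "w = v \<or> w = rev v"
proof -
  obtain v' where v': "v' = v \<or> v' = rev v" "suffix v' (pre u (first_end u v))"
    using assms(1) by (rule first_end_suffix)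
  obtain w' where w': "w' = w \<or> w' = rev w" "suffix w' (pre u (first_end u v))"
    using assms(2,4) first_end_suffix by metis
  have "length v' = length w'"
    using v' w' assms(3) by auto
  then have "v' = w'"
    using v'(2) w'(2) by (auto simp: suffix_def)
  then show ?thesis
    using v'(1) w'(1) by auto
qed

lemma first_end_rev: "first_end u (rev v) = first_end u v"
  unfolding first_end_def by (rule arg_cong[of _ _ Least]) auto

text \<open>If the values agreed, \<open>v\<close> or its reversal, called \<open>v'\<close>, would
  be a proper suffix of \<open>q\<close>. Reflecting \<open>q\<close> makes \<open>rev v'\<close> a
  proper prefix of that occurrence of \<open>q\<close>, so it ends strictly earlier, against
  minimality.\<close>

lemma first_end_shorter_neq_palindrome:
  assumes "v \<in> language u" "q \<in> language u" "palindrome q" "length v < length q"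
  shows "first_end u v \<noteq> first_end u q"
proof
  assume eq: "first_end u v = first_end u q"
  obtain v' where v': "v' = v \<or> v' = rev v" "suffix v' (pre u (first_end u q))"
    using assms(1) eq first_end_suffix by metis
  have "suffix q (pre u (first_end u q))"
    using first_end_suffix[OF assms(2)] assms(3) unfolding palindrome_def by metis
  then obtain a where a: "pre u (first_end u q) = a @ q"
    by (auto simp: suffix_def)
  have "suffix v' q"
    using v' \<open>suffix q _\<close> assms(4) by (metis length_rev less_imp_le suffix_length_suffix)
  then have "prefix (rev v') q"
    using assms(3) by (metis palindrome_def suffix_to_prefix)
  then obtain b where b: "q = rev v' @ b"
    by (auto simp: prefix_def)
  have "b \<noteq> []"
    using b v'(1) assms(4) by auto
  have "pre u (first_end u q) = (a @ rev v') @ b"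
    using a b by simp
  then have "a @ rev v' = pre u (length (a @ rev v'))"
    by (rule pre_eq_append)
  then have "sublist (rev v') (pre u (length (a @ rev v')))"
    by (metis sublist_appendI append_Nil2)
  then have "first_end u v \<le> length (a @ rev v')"
    using v'(1) by (intro first_end_le) auto
  moreover have "first_end u q = length (a @ rev v') + length b"
    using arg_cong[OF a, of length] b by simp
  ultimately show False
    using eq \<open>b \<noteq> []\<close> by simp
qed

text \<open>Different lengths are excluded by the preceding lemma; for equal lengths,
  \<open>q = p\<close> or \<open>q = rev p = p\<close>.\<close>

lemma inj_on_first_end_palindromes: "inj_on (first_end u) {p \<in> language u. palindrome p}"
proof (rule inj_onI)
  fix p q assume pq: "p \<in> {p \<in> language u. palindrome p}" "q \<in> {p \<in> language u. palindrome p}"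
    "first_end u p = first_end u q"
  then have "length p = length q"
    using first_end_shorter_neq_palindrome by (metis (mono_tags, lifting) linorder_neqE_nat mem_Collect_eq)
  then show "p = q"
    using first_end_eq_imp[of p u q] pq by (auto simp: palindrome_def)
qed

section \<open>Complexities and partial sums as counts\<close>

lemma finite_language_n:
  assumes "finite (range u)"
  shows "finite (language_n u n)"
proof (rule finite_subset)
  show "language_n u n \<subseteq> {w. set w \<subseteq> range u \<and> length w = n}"
    by (force simp: language_n_def language_def dest: arg_cong[where f = set])
qed (use assms finite_lists_length_eq in blast)

lemma finite_sublists: "finite {p. sublist p w \<and> Q p}"
  by (rule finite_subset[of _ "set (sublists w)"]) auto

definition short_palindromes :: "(nat \<Rightarrow> 'a) \<Rightarrow> nat \<Rightarrow> 'a list set" where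
  "short_palindromes u N = {p \<in> language u. palindrome p \<and> length p \<le> N}"

lemma short_palindromes_Suc:
  "short_palindromes u (Suc N) = short_palindromes u N \<union> {w \<in> language_n u (Suc N). palindrome w}"
  by (auto simp: short_palindromes_def language_n_def)

lemma language_n_0: "language_n u 0 = {[]}"
  by (auto simp: language_n_def language_def)

lemma short_palindromes_0: "short_palindromes u 0 = {[]}"
  by (auto simp: short_palindromes_def language_def palindrome_def)

lemma finite_short_palindromes:
  assumes "finite (range u)"
  shows "finite (short_palindromes u N)"
  by (induction N) (simp_all add: short_palindromes_0 short_palindromes_Suc finite_language_n[OF assms])

lemma card_short_palindromes_Suc:
  assumes "finite (range u)"
  shows "card (short_palindromes u (Suc N)) =
    card (short_palindromes u N) + palindromic_complexity u (Suc N)"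
proof -
  have "short_palindromes u N \<inter> {w \<in> language_n u (Suc N). palindrome w} = {}"
    by (auto simp: short_palindromes_def language_n_def)
  then show ?thesis
    unfolding short_palindromes_Suc palindromic_complexity_def
    using finite_short_palindromes[OF assms] finite_language_n[OF assms]
    by (simp add: card_Un_disjoint)
qed

text \<open>Adding P(n+1) + P(n) counts every palindrome of length at most \<open>N\<close> twice,
  except that lengths 0 and \<open>N\<close> are counted once. The boundary terms C(0) and P(0) are
  both 1 and cancel.\<close>

lemma sum_T:
  assumes "finite (range u)"
  shows "(\<Sum>n<N. T u n) = int (factor_complexity u N) + int (palindromic_complexity u N)
    + 2 * int N - 2 * int (card (short_palindromes u N))"
proof (induction N)
  case 0
  have "{w \<in> language_n u 0. palindrome w} = {[]}"
    by (auto simp: palindrome_def language_n_0)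
  then show ?case
    by (simp add: factor_complexity_def palindromic_complexity_def short_palindromes_0)
      (simp add: language_n_0)
next
  case (Suc N)
  then show ?case
    by (simp add: T_def card_short_palindromes_Suc[OF assms])
qed

text \<open>Weight palindromes by 2 and other words by 1. The fibres of \<open>first_end\<close> on
  words of length \<open>N\<close> are the sets \<open>{w, rev w}\<close>, whole by closure under
  reversal, and each has total weight 2.\<close>

lemma complexities_eq_card_first_end:
  assumes fin: "finite (range u)" and closed: "closed_under_reversal u"
  shows "factor_complexity u N + palindromic_complexity u N = 2 * card (first_end u ` language_n u N)"
proof -
  let ?L = "language_n u N"
  let ?g = "\<lambda>v. if palindrome v then 2 else 1 :: nat"
  have finL: "finite ?L"
    by (rule finite_language_n[OF fin])
  have fibre: "(\<Sum>v\<in>{v \<in> ?L. first_end u v = first_end u w}. ?g v) = 2" if w: "w \<in> ?L" for w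
  proof -
    have "rev w \<in> ?L"
      using w closed by (auto simp: language_n_def closed_under_reversal_def)
    moreover have "v = w \<or> v = rev w" if "v \<in> ?L" "first_end u v = first_end u w" for v
      using that w by (intro first_end_eq_imp[of w u v]) (auto simp: language_n_def)
    ultimately have "{v \<in> ?L. first_end u v = first_end u w} = {w, rev w}"
      using w by (auto simp: first_end_rev)
    then show ?thesis
      by (cases "w = rev w") (auto simp: palindrome_def)
  qed
  have "factor_complexity u N + palindromic_complexity u N = (\<Sum>v\<in>?L. 1 + (if palindrome v then 1 else 0))"
    unfolding sum.distrib using finL
    by (simp add: factor_complexity_def palindromic_complexity_def sum.If_cases Int_def)
  also have "\<dots> = (\<Sum>v\<in>?L. ?g v)"
    by (rule sum.cong) auto
  also have "\<dots> = (\<Sum>j\<in>first_end u ` ?L. \<Sum>v\<in>{v \<in> ?L. first_end u v = j}. ?g v)"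
    by (rule sum.image_gen[OF finL])
  also have "\<dots> = (\<Sum>j\<in>first_end u ` ?L. 2)"
    using fibre by (intro sum.cong) auto
  finally show ?thesis
    by simp
qed

section \<open>Comparing partial sums with defects of prefixes\<close>

lemma word_defect_pre_mono: "mono (\<lambda>n. word_defect (pre u n))"
proof (rule monoI, rule lift_Suc_mono_le[of "\<lambda>n. word_defect (pre u n)"])
  fix n
  let ?P = "\<lambda>n. {p. sublist p (pre u n) \<and> palindrome p}"
  let ?New = "?P (Suc n) - ?P n"
  \<comment> \<open>All palindromes new in the longer prefix share one value of
    \<open>first_end\<close>, so by injectivity there is at most one: the length grows by one and
    the palindrome count by at most one.\<close>
  have "first_end u ` ?New \<subseteq> {Suc n}"
  proof
    fix j assume "j \<in> first_end u ` ?New"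
    then obtain p where p: "sublist p (pre u (Suc n))" "palindrome p" "\<not> sublist p (pre u n)"
      and j: "j = first_end u p"
      by auto
    have "j \<le> Suc n"
      unfolding j using p by (intro first_end_le) auto
    moreover have "\<not> j \<le> n"
      using p sublist_pre_imp_language[OF p(1)] by (simp add: j palindrome_sublist_pre_iff)
    ultimately show "j \<in> {Suc n}"
      by simp
  qed
  then have "card (first_end u ` ?New) \<le> 1"
    using card_mono[of "{Suc n}"] by simp
  moreover have "card (first_end u ` ?New) = card ?New"
    by (intro card_image inj_on_subset[OF inj_on_first_end_palindromes])
      (use sublist_pre_imp_language in blast)
  moreover have "card (?P (Suc n)) \<le> card (?P n) + card ?New"
    by (rule order.trans[OF card_mono card_Un_le]) (auto simp: finite_sublists)
  ultimately show "word_defect (pre u n) \<le> word_defect (pre u (Suc n))"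
    by (simp add: word_defect_def)
qed

lemma word_defect_pre_le_sum_T:
  assumes fin: "finite (range u)" and closed: "closed_under_reversal u"
  shows "2 * word_defect (pre u N) \<le> (\<Sum>n<N. T u n)"
proof -
  let ?L = "language_n u N"
  let ?P = "{p. sublist p (pre u N) \<and> palindrome p}"
  let ?Q = "short_palindromes u N - ?P"
  have finL: "finite ?L"
    by (rule finite_language_n[OF fin])
  have preN: "pre u N \<in> ?L"
    using sublist_pre_imp_language[of "pre u N" u N] by (simp add: language_n_def)
  have "first_end u (pre u N) = N"
    using length_le_first_end[of "pre u N" u] preN first_end_le[of "pre u N" u N]
    by (auto simp: language_n_def)
  then have N: "N \<in> first_end u ` ?L"
    using preN by force
  \<comment> \<open>Missing palindromes end beyond \<open>N\<close>, so the value \<open>N\<close>,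
    taken by the prefix itself, is left out. This spare value pays for the \<open>+ 1\<close> in the
    defect.\<close>
  have "first_end u ` ?Q \<subseteq> first_end u ` ?L - {N}"
  proof
    fix j assume "j \<in> first_end u ` ?Q"
    then obtain p where p: "p \<in> language u" "palindrome p" "length p \<le> N" "\<not> sublist p (pre u N)"
      and j: "j = first_end u p"
      by (auto simp: short_palindromes_def)
    have sub: "sublist p (pre u j)"
      using p(1,2) by (simp add: j palindrome_sublist_pre_iff)
    have "N < j"
      using p by (simp add: j palindrome_sublist_pre_iff)
    \<comment> \<open>The word of length \<open>N\<close> ending where \<open>p\<close> first ends;
      it is to be shown that \<open>v\<close> is new there up to reversal.\<close>
    define v where "v = drop (j - N) (pre u j)"
    have v: "suffix v (pre u j)" "length v = N"
      using \<open>N < j\<close> by (auto simp: v_def suffix_drop)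
    have vL: "v \<in> ?L"
      using v sublist_pre_imp_language[of v u j] by (auto simp: language_n_def)
    have "suffix p (pre u j)"
      using sub sublist_pre_first_end_imp_suffix[of p u p] by (simp add: j)
    then have "suffix p v"
      using v p(3) suffix_length_suffix by metis
    then have "sublist p v"
      by blast
    \<comment> \<open>Since \<open>p\<close> is its own reversal, it lies in both \<open>v\<close>
      and \<open>rev v\<close>; so neither can occur before \<open>p\<close> does.\<close>
    moreover from this have "sublist (rev p) (rev v)"
      by simp
    then have "sublist p (rev v)"
      using p(2) unfolding palindrome_def by argo
    ultimately have "sublist p (pre u (first_end u v))"
      using first_end_sublist[of v u] vL
      by (auto simp: language_n_def intro: sublist_order.order_trans)
    then have "j \<le> first_end u v"
      unfolding j by (intro first_end_le) auto
    moreover have "first_end u v \<le> j"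
      using v by (intro first_end_le) auto
    ultimately show "j \<in> first_end u ` ?L - {N}"
      using vL \<open>N < j\<close> by auto
  qed
  then have "card (first_end u ` ?Q) \<le> card (first_end u ` ?L - {N})"
    using finL by (intro card_mono) auto
  then have "card (first_end u ` ?Q) \<le> card (first_end u ` ?L) - 1"
    using N by simp
  \<comment> \<open>Keeps the natural-number subtraction above from truncating.\<close>
  moreover have "card (first_end u ` ?L) \<ge> 1"
    using finL N card_gt_0_iff[of "first_end u ` ?L"] by (simp add: Suc_le_eq) blast
  moreover have "card (first_end u ` ?Q) = card ?Q"
    by (intro card_image inj_on_subset[OF inj_on_first_end_palindromes])
      (auto simp: short_palindromes_def)
  moreover have "card (short_palindromes u N) \<le> card ?P + card ?Q"
    using finite_short_palindromes[OF fin]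
    by (intro order.trans[OF card_mono card_Un_le]) (auto simp: finite_sublists)
  ultimately show ?thesis
    using complexities_eq_card_first_end[OF fin closed, of N]
    by (simp add: sum_T[OF fin] word_defect_def)
qed

lemma sum_T_le_word_defect_pre:
  assumes fin: "finite (range u)" and closed: "closed_under_reversal u"
  shows "\<exists>M. (\<Sum>n<N. T u n) \<le> 2 * word_defect (pre u M)"
proof -
  let ?L = "language_n u N" and ?S = "short_palindromes u N"
  have finL: "finite ?L" and finS: "finite ?S"
    by (rule finite_language_n[OF fin], rule finite_short_palindromes[OF fin])
  \<comment> \<open>A prefix long enough to contain every factor of length \<open>N\<close> up to
    reversal and every palindrome of length at most \<open>N\<close>.\<close>
  define M where "M = Max (first_end u ` (?L \<union> ?S) \<union> {N})"
  have M: "first_end u v \<le> M" if "v \<in> ?L \<union> ?S" for v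
    unfolding M_def using finL finS that by (intro Max_ge) auto
  have NM: "N \<le> M"
    unfolding M_def using finL finS by (intro Max_ge) auto
  let ?P = "{p. sublist p (pre u M) \<and> palindrome p}"
  let ?Q = "{p. sublist p (pre u M) \<and> palindrome p \<and> N < length p}"
  have P: "?P = ?S \<union> ?Q"
  proof -
    have "sublist p (pre u M)" if "p \<in> ?S" for p
      using that M[of p] by (simp add: short_palindromes_def palindrome_sublist_pre_iff)
    then show ?thesis
      by (auto simp: short_palindromes_def dest: sublist_pre_imp_language)
  qed
  have "card ?P = card ?S + card ?Q"
    unfolding P using finS
    by (intro card_Un_disjoint) (auto simp: finite_sublists short_palindromes_def)
  moreover have "card (first_end u ` ?Q) = card ?Q"
    by (intro card_image inj_on_subset[OF inj_on_first_end_palindromes])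
      (auto intro: sublist_pre_imp_language)
  moreover have "card (first_end u ` ?L \<union> first_end u ` ?Q) =
      card (first_end u ` ?L) + card (first_end u ` ?Q)"
  proof (rule card_Un_disjoint)
    show "first_end u ` ?L \<inter> first_end u ` ?Q = {}"
    proof -
      have "first_end u v \<noteq> first_end u q" if "v \<in> ?L" "q \<in> ?Q" for v q
        using that sublist_pre_imp_language[of q u M]
        by (intro first_end_shorter_neq_palindrome) (auto simp: language_n_def)
      then show ?thesis
        by blast
    qed
  qed (use finL in \<open>auto simp: finite_sublists\<close>)
  \<comment> \<open>No word of length at least \<open>N\<close> ends before \<open>N\<close>, so the
    two disjoint images share the \<open>M - N + 1\<close> positions of \<open>{N..M}\<close>; this
    bounds the number of long palindromes.\<close>
  moreover have "first_end u ` ?L \<union> first_end u ` ?Q \<subseteq> {N..M}"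
  proof -
    have "N \<le> first_end u v" "first_end u v \<le> M" if "v \<in> ?L" for v
      using that M[of v] length_le_first_end[of v u] by (auto simp: language_n_def)
    moreover have "N \<le> first_end u q" "first_end u q \<le> M" if "q \<in> ?Q" for q
      using that sublist_pre_imp_language[of q u M] length_le_first_end[of q u] first_end_le[of q u M]
      by auto
    ultimately show ?thesis
      by auto
  qed
  then have "card (first_end u ` ?L \<union> first_end u ` ?Q) \<le> Suc M - N"
    by (metis card_atLeastAtMost card_mono finite_atLeastAtMost)
  ultimately have "(\<Sum>n<N. T u n) \<le> 2 * word_defect (pre u M)"
    using complexities_eq_card_first_end[OF fin closed, of N] NM
    by (simp add: sum_T[OF fin] word_defect_def)
  then show ?thesis ..
qed

section \<open>Passage to the limit\<close>

theorem theorem4p1: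
  fixes u :: "nat \<Rightarrow> 'a" and A :: "'a set"
  assumes "finite A" and "range u \<subseteq> A"
    and "uniformly_recurrent u"
    and "closed_under_reversal u"
  shows "(\<lambda>n. ereal (of_int (T u n))) sums (2 * defect u)"
proof -
  have fin: "finite (range u)"
    using assms(1,2) finite_subset by blast
  let ?d = "\<lambda>N. ereal (of_int (word_defect (pre u N)))"
  let ?s = "\<lambda>N. \<Sum>n<N. ereal (of_int (T u n))"
  have s: "?s N = ereal (of_int (\<Sum>n<N. T u n))" for N
    by simp
  have "?d \<longlonglongrightarrow> defect u"
    unfolding defect_def using word_defect_pre_mono[of u]
    by (intro LIMSEQ_SUP) (auto simp: mono_def)
  \<comment> \<open>Multiplication by the finite constant 2 is continuous on the extended reals,
    also at infinity.\<close>
  then have lim: "(\<lambda>N. 2 * ?d N) \<longlonglongrightarrow> 2 * defect u"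
    by (intro tendsto_cmult_ereal) auto
  have lower: "2 * ?d N \<le> ?s N" for N
  proof -
    have "2 * ?d N = ereal (of_int (2 * word_defect (pre u N)))"
      by simp
    also have "\<dots> \<le> ?s N"
      unfolding s ereal_less_eq of_int_le_iff
      by (rule word_defect_pre_le_sum_T[OF fin assms(4)])
    finally show ?thesis .
  qed
  have upper: "?s N \<le> 2 * defect u" for N
  proof -
    obtain M where "(\<Sum>n<N. T u n) \<le> 2 * word_defect (pre u M)"
      using sum_T_le_word_defect_pre[OF fin assms(4)] by blast
    then have "?s N \<le> ereal (of_int (2 * word_defect (pre u M)))"
      unfolding s ereal_less_eq of_int_le_iff .
    also have "\<dots> = 2 * ?d M"
      by simp
    also have "\<dots> \<le> 2 * defect u"
      unfolding defect_def by (intro ereal_mult_left_mono SUP_upper) auto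
    finally show ?thesis .
  qed
  \<comment> \<open>The partial sums are squeezed between a sequence tending to
    \<open>2 * defect u\<close> and that value itself, whether finite or infinite.\<close>
  show ?thesis
    unfolding sums_def
    by (rule tendsto_sandwich[OF _ _ lim tendsto_const]) (use lower upper in auto)
qed

end
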